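(* Let $1\le s\le d$ be integers, $a,\sigma>0$, $0<\delta<1$, $0<\alpha<1$. For any given level $0<\alpha'<\alpha$, provided $$\frac a\sigma\ge\phi^*:=\Phi^{-1}\Big(\frac{\delta+1}2\Big)-\Phi^{-1}\Big(\frac{\alpha'}{2s}\Big),$$ we have $$\sup_{\theta\in\Theta(s,a),\ \theta_j=0}\mathbb P_\theta(j\in\hat S^{TS}_{\alpha'})\le1-\delta\quad(j\in[d]),\qquad\sup_{\theta\in\Theta(s,a)}\mathbb P_\theta(\theta\notin\hat M^{TS}_{\alpha'})\le\alpha .$$ Here $$\hat S^{TS}_{\alpha'}=\Big\{j\in[d]:\ \frac{|X_j|}\sigma\ge\Big(\Phi^{-1}\big(\tfrac{\alpha'}{2s}\big)+\frac a\sigma\Big)_+\vee\Phi^{-1}\Big(\frac{1+\delta}2\Big)\Big\},$$ $\hat M^{TS}_{\alpha'}=M(\hat S^{TS}_{\alpha'},\hat U^{TS},\hat L^{TS})$ with $\hat L^{TS}_j=X_j-\hat u^{TS}_{\alpha'}\sigma$, $\hat U^{TS}_j=X_j+\hat u^{TS}_{\alpha'}\sigma$ for $j\in\hat S^{TS}_{\alpha'}$, and $$\hat u^{TS}_{\alpha'}=\begin{cases}\Phi^{-1}\Big(1-\dfrac{\alpha-\alpha'}{2d}\Big)&\text{if }\phi^*\le\dfrac a\sigma<\phi^*\vee\Big[-\Phi^{-1}\big(\frac{\alpha-\alpha'}{2d}\big)-\Phi^{-1}\big(\frac{\alpha'}{2s}\big)\Big],\\[3mm]\Phi^{-1}\Big(1-\dfrac{\alpha-\alpha'-2(d-s)(1-\eta)}{2s}\Big)&\text{if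 }\dfrac a\sigma\ge\phi^*\vee\Big[-\Phi^{-1}\big(\frac{\alpha-\alpha'}{2d}\big)-\Phi^{-1}\big(\frac{\alpha'}{2s}\big)\Big],\end{cases}$$ where $\eta=\Phi\big(a/\sigma+\Phi^{-1}(\alpha'/(2s))\big)$.
   Context: $X=(X_1,\dots,X_d)\sim N(\theta,\sigma^2 I_d)$ with $\theta\in\mathbb R^d$ unknown and $\sigma>0$ known; $\mathbb P_\theta$ is the corresponding probability. $\Phi$ is the standard normal c.d.f., $x\vee y=\max(x,y)$, $(x)_+=\max(x,0)$, $[d]=\{1,\dots,d\}$, $\|\theta\|_0=|\{j:\theta_j\neq0\}|$. The parameter space is $$\Theta(s,a)=\{\theta\in\mathbb R^d:\ \|\theta\|_0\le s,\ \min_{j:\theta_j\neq0}|\theta_j|\ge a\}.$$ For a random subset $S=S(X)\subseteq[d]$ and confidence bounds $L_j=L_j(X)$, $U_j=U_j(X)$, $$M(S,U,L)=\{\theta\in\mathbb R^d:\ \theta_j=0\text{ for all }j\in S^c,\ \theta_j\in[L_j,U_j]\text{ for all }j\in S\}.$$ *)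

theory Defs
  imports "HOL-Probability.Probability"
begin

text \<open>
  The dimension \<open>d\<close> is \<open>CARD('d)\<close> for a finite index type \<open>'d\<close>, so that \<open>[d]\<close> is
  \<open>UNIV :: 'd set\<close> and the parameter and the observation are vectors in \<open>real ^ 'd\<close>.
\<close>

definition Phi :: "real \<Rightarrow> real" where
  "Phi = cdf std_normal_distribution"

text \<open>
  \<open>Phi\<close> is a bijection from the reals onto the open interval from 0 to 1; only values of
  \<open>Phi_inv\<close> at points of that interval are meaningful.
\<close>

definition Phi_inv :: "real \<Rightarrow> real" where
  "Phi_inv = inv Phi"

text \<open>
  The law \<open>N(\<theta>, \<sigma>\<^sup>2 I)\<close>: independent coordinates \<open>X\<^sub>j\<close> with laws \<open>N(\<theta>\<^sub>j, \<sigma>\<^sup>2)\<close>. The second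
  parameter of \<open>normal_density\<close> is the standard deviation.
\<close>

definition isotropic_normal :: "real ^ 'd \<Rightarrow> real \<Rightarrow> (real ^ 'd) measure" where
  "isotropic_normal \<theta> \<sigma> =
     distr (\<Pi>\<^sub>M j\<in>UNIV. density lborel (normal_density (\<theta> $ j) \<sigma>)) borel (\<lambda>x. \<chi> j. x j)"

text \<open>The zero vector belongs to every \<open>Theta s a\<close>: a minimum over the empty support is no constraint.\<close>

definition Theta :: "nat \<Rightarrow> real \<Rightarrow> (real ^ 'd) set" where
  "Theta s a = {\<theta>. card {j. \<theta> $ j \<noteq> 0} \<le> s \<and> (\<forall>j. \<theta> $ j \<noteq> 0 \<longrightarrow> a \<le> \<bar>\<theta> $ j\<bar>)}"

definition conf_set :: "'d set \<Rightarrow> real ^ 'd \<Rightarrow> real ^ 'd \<Rightarrow> (real ^ 'd) set" where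
  "conf_set S U L = {\<theta>. (\<forall>j. j \<notin> S \<longrightarrow> \<theta> $ j = 0) \<and> (\<forall>j\<in>S. \<theta> $ j \<in> {L $ j .. U $ j})}"

definition phi_star :: "nat \<Rightarrow> real \<Rightarrow> real \<Rightarrow> real" where
  "phi_star s \<delta> \<alpha>' = Phi_inv ((\<delta> + 1) / 2) - Phi_inv (\<alpha>' / (2 * real s))"

definition S_TS :: "nat \<Rightarrow> real \<Rightarrow> real \<Rightarrow> real \<Rightarrow> real \<Rightarrow> real ^ 'd \<Rightarrow> 'd set" where
  "S_TS s a \<sigma> \<delta> \<alpha>' X =
     {j. \<bar>X $ j\<bar> / \<sigma> \<ge>
           max (max (Phi_inv (\<alpha>' / (2 * real s)) + a / \<sigma>) 0) (Phi_inv ((1 + \<delta>) / 2))}"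

text \<open>When \<open>phi_star s \<delta> \<alpha>' \<le> a / \<sigma>\<close>, the \<open>else\<close> branch is the case \<open>a / \<sigma> \<ge> t\<close>.\<close>

definition u_TS :: "nat \<Rightarrow> nat \<Rightarrow> real \<Rightarrow> real \<Rightarrow> real \<Rightarrow> real \<Rightarrow> real \<Rightarrow> real" where
  "u_TS d s a \<sigma> \<delta> \<alpha> \<alpha>' =
     (let t = max (phi_star s \<delta> \<alpha>')
                (- Phi_inv ((\<alpha> - \<alpha>') / (2 * real d)) - Phi_inv (\<alpha>' / (2 * real s)));
          \<eta> = Phi (a / \<sigma> + Phi_inv (\<alpha>' / (2 * real s)))
      in if phi_star s \<delta> \<alpha>' \<le> a / \<sigma> \<and> a / \<sigma> < t
         then Phi_inv (1 - (\<alpha> - \<alpha>') / (2 * real d))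
         else Phi_inv (1 - (\<alpha> - \<alpha>' - 2 * (real d - real s) * (1 - \<eta>)) / (2 * real s)))"

definition L_TS :: "nat \<Rightarrow> real \<Rightarrow> real \<Rightarrow> real \<Rightarrow> real \<Rightarrow> real \<Rightarrow> real ^ 'd \<Rightarrow> real ^ 'd" where
  "L_TS s a \<sigma> \<delta> \<alpha> \<alpha>' X = (\<chi> j. X $ j - u_TS CARD('d) s a \<sigma> \<delta> \<alpha> \<alpha>' * \<sigma>)"

definition U_TS :: "nat \<Rightarrow> real \<Rightarrow> real \<Rightarrow> real \<Rightarrow> real \<Rightarrow> real \<Rightarrow> real ^ 'd \<Rightarrow> real ^ 'd" where
  "U_TS s a \<sigma> \<delta> \<alpha> \<alpha>' X = (\<chi> j. X $ j + u_TS CARD('d) s a \<sigma> \<delta> \<alpha> \<alpha>' * \<sigma>)"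

definition M_TS :: "nat \<Rightarrow> real \<Rightarrow> real \<Rightarrow> real \<Rightarrow> real \<Rightarrow> real \<Rightarrow> real ^ 'd \<Rightarrow> (real ^ 'd) set" where
  "M_TS s a \<sigma> \<delta> \<alpha> \<alpha>' X =
     conf_set (S_TS s a \<sigma> \<delta> \<alpha>' X) (U_TS s a \<sigma> \<delta> \<alpha> \<alpha>' X) (L_TS s a \<sigma> \<delta> \<alpha> \<alpha>' X)"

text \<open>
  The events whose probabilities are bounded are Borel sets (\<open>measure\<close> is 0 on non-measurable
  sets), and \<open>isotropic_normal\<close> is a probability measure.
\<close>

lemma space_isotropic_normal [simp]: "space (isotropic_normal \<theta> \<sigma>) = UNIV"
  by (simp add: isotropic_normal_def)

lemma sets_isotropic_normal [simp, measurable_cong]: "sets (isotropic_normal \<theta> \<sigma>) = sets borel"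
  by (simp add: isotropic_normal_def)

lemma measurable_vec_lambda_PiM:
  fixes M :: "'d :: finite \<Rightarrow> real measure"
  assumes "\<And>j. sets (M j) = sets borel"
  shows "(\<lambda>x. \<chi> j. x j) \<in> borel_measurable (\<Pi>\<^sub>M j\<in>UNIV. M j)"
proof (rule borel_measurable_euclidean_space[THEN iffD2, rule_format])
  fix b :: "real ^ 'd" assume "b \<in> Basis"
  then obtain i where b: "b = axis i 1" by (auto simp: Basis_vec_def)
  have "(\<lambda>x. x i) \<in> measurable (\<Pi>\<^sub>M j\<in>UNIV. M j) (M i)" by simp
  then have "(\<lambda>x. x i) \<in> borel_measurable (\<Pi>\<^sub>M j\<in>UNIV. M j)"
    using measurable_cong_sets[OF refl assms] by blast
  then show "(\<lambda>x. (\<chi> j. x j) \<bullet> b) \<in> borel_measurable (\<Pi>\<^sub>M j\<in>UNIV. M j)"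
    by (simp add: b inner_axis)
qed

lemma prob_space_isotropic_normal:
  assumes "\<sigma> > 0"
  shows "prob_space (isotropic_normal \<theta> \<sigma>)"
proof -
  interpret product_prob_space "\<lambda>j. density lborel (normal_density (\<theta> $ j) \<sigma>)" UNIV
    by (intro product_prob_spaceI prob_space_normal_density assms)
  show ?thesis
    unfolding isotropic_normal_def
    by (intro prob_space_distr measurable_vec_lambda_PiM) simp
qed

lemma borel_selection_event:
  "{X :: real ^ 'd. j \<in> S_TS s a \<sigma> \<delta> \<alpha>' X} \<in> sets borel"
  unfolding S_TS_def by simp measurable

lemma borel_noncoverage_event:
  "{X :: real ^ 'd. \<theta> \<notin> M_TS s a \<sigma> \<delta> \<alpha> \<alpha>' X} \<in> sets borel"
  unfolding M_TS_def conf_set_def S_TS_def L_TS_def U_TS_def by simp measurable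

end

theory Submission
  imports Defs
begin

text \<open>
  Since \<open>a / \<sigma> \<ge> \<phi>\<^sup>*\<close>, the selection threshold is just \<open>c = \<Phi>\<^sup>-\<^sup>1(\<alpha>' / 2s) + a / \<sigma>\<close>.
  A nonzero coordinate is then missed with probability at most \<open>\<Phi>(c - a / \<sigma>) = \<alpha>' / 2s\<close>, so that some
  signal is missed with probability at most \<open>\<alpha>' / 2\<close>. The tails beyond \<open>u\<close> either are summed over
  all \<open>d\<close> coordinates, or are used only on \<open>s\<close> coordinates containing the support, the remaining
  \<open>d - s\<close> being charged their false-selection probability \<open>2 (1 - \<eta>)\<close>. The two branches defining \<open>u\<close>
  make these sums equal to \<open>\<alpha> - \<alpha>'\<close>; for the second one, the condition on \<open>a / \<sigma>\<close> makes the argument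
  of \<open>\<Phi>\<^sup>-\<^sup>1\<close> less than 1.
\<close>

section \<open>The standard normal distribution function, its inverse and its tails\<close>

interpretation std_normal: real_distribution std_normal_distribution
  by (rule real_dist_normal_dist)

lemma mono_Phi: "mono Phi"
  unfolding Phi_def by (intro monoI std_normal.cdf_nondecreasing)

lemma measure_std_normal_singleton: "measure std_normal_distribution {x} = 0"
  by (simp add: measure_def emeasure_density nn_integral_indicator_singleton')

lemma measure_std_normal_greaterThan: "measure std_normal_distribution {x<..} = 1 - Phi x"
proof -
  have "{x<..} = space std_normal_distribution - {..x}"
    by auto
  then show ?thesis
    using std_normal.prob_compl[of "{..x}"] by (simp add: Phi_def cdf_def)
qed

text \<open>The standard normal law is invariant under \<open>x \<mapsto> - x\<close>, an affine map
  of scale -1 and shift 0. Reflection turns a left tail into a closed right tail, and the absence of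
  atoms makes that tail open.\<close>

lemma Phi_minus: "Phi (- x) = 1 - Phi x"
proof -
  have "distributed std_normal_distribution lborel (\<lambda>x. x) std_normal_density"
    by (simp add: distributed_def distr_id2)
  from std_normal.normal_density_affine[OF this, of "-1" 0]
  have "distributed std_normal_distribution lborel (\<lambda>x. - x) std_normal_density"
    by simp
  then have *: "distr std_normal_distribution borel uminus = std_normal_distribution"
    by (simp add: distributed_def distr_cong[of _ _ borel lborel])
  have "Phi (- x) = measure (distr std_normal_distribution borel uminus) {..- x}"
    unfolding * by (simp add: Phi_def cdf_def)
  also have "\<dots> = measure std_normal_distribution {x..}"
    by (subst measure_distr) (auto simp: vimage_def intro!: arg_cong[where f = "measure _"])
  also have "{x..} = {x} \<union> {x<..}"
    by auto
  also have "measure std_normal_distribution ({x} \<union> {x<..}) = measure std_normal_distribution {x<..}"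
    by (subst std_normal.finite_measure_Union) (auto simp: measure_std_normal_singleton)
  finally show ?thesis
    by (simp add: measure_std_normal_greaterThan)
qed

lemma Phi_zero: "Phi 0 = 1 / 2"
  using Phi_minus[of 0] by simp

text \<open>\<open>inv\<close> picks some preimage, so it is enough that \<open>p\<close> lies in
  the range of \<open>Phi\<close>. This follows from the intermediate value theorem:
  \<open>Phi\<close> has limits 0 and 1 and is continuous because the law has no atoms.\<close>

lemma Phi_Phi_inv:
  assumes "0 < p" "p < 1"
  shows "Phi (Phi_inv p) = p"
proof -
  have "eventually (\<lambda>x. p < Phi x) at_top"
    using std_normal.cdf_lim_at_top_prob assms unfolding Phi_def by (auto dest: order_tendstoD)
  then obtain y where y: "p < Phi y"
    by (auto simp: eventually_at_top_linorder)
  have "eventually (\<lambda>x. Phi x < p) at_bot"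
    using std_normal.cdf_lim_at_bot assms unfolding Phi_def by (auto dest: order_tendstoD)
  then obtain x where x: "Phi x < p"
    by (auto simp: eventually_at_bot_linorder)
  have "x \<le> y"
    using x y monoD[OF mono_Phi, of y x] by linarith
  moreover have "\<forall>z. x \<le> z \<and> z \<le> y \<longrightarrow> isCont Phi z"
    unfolding Phi_def by (simp add: std_normal.isCont_cdf measure_std_normal_singleton)
  ultimately have "p \<in> range Phi"
    using IVT[of Phi x p y] x y by auto
  then show ?thesis
    unfolding Phi_inv_def by (rule f_inv_into_f)
qed

text \<open>As an inequality this holds for every real \<open>t\<close>: for negative
  \<open>t\<close> the two tails overlap and the right side exceeds 1. So no sign of a threshold or
  of \<open>u\<close> has to be established later.\<close>

lemma std_normal_two_sided_tail:
  "measure std_normal_distribution {x. t \<le> \<bar>x\<bar>} \<le> 2 * (1 - Phi t)"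
proof -
  have "measure std_normal_distribution {x. t \<le> \<bar>x\<bar>}
      \<le> measure std_normal_distribution ({..- t} \<union> ({t} \<union> {t<..}))"
    by (intro std_normal.finite_measure_mono) auto
  also have "\<dots> \<le> measure std_normal_distribution {..- t} + (measure std_normal_distribution {t}
      + measure std_normal_distribution {t<..})"
    by (intro order.trans[OF measure_Un_le] add_left_mono) auto
  also have "measure std_normal_distribution {..- t} = 1 - Phi t"
    by (simp add: Phi_minus[symmetric]) (simp add: Phi_def cdf_def)
  finally show ?thesis
    by (simp add: measure_std_normal_singleton measure_std_normal_greaterThan)
qed

section \<open>Events that depend on one coordinate of the observation\<close>

lemma distr_isotropic_normal_standardized:
  fixes \<theta> :: "real ^ 'd :: finite"
  assumes "\<sigma> > 0"
  shows "distr (isotropic_normal \<theta> \<sigma>) borel (\<lambda>X. (X $ j - \<theta> $ j) / \<sigma>) = std_normal_distribution"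
proof -
  let ?N = "\<lambda>j. density lborel (normal_density (\<theta> $ j) \<sigma>)"
  have N: "prob_space (?N i)" for i
    using assms by (rule prob_space_normal_density)
  have comp: "distr (isotropic_normal \<theta> \<sigma>) borel (\<lambda>X. X $ j) = ?N j"
  proof -
    have "distr (isotropic_normal \<theta> \<sigma>) borel (\<lambda>X. X $ j)
        = distr (Pi\<^sub>M UNIV ?N) borel (\<lambda>x. x j)"
      unfolding isotropic_normal_def
      by (subst distr_distr) (auto simp: comp_def intro!: measurable_vec_lambda_PiM)
    \<comment> \<open>\<open>distr\<close> depends on its target only through the sigma-algebra; the
      factor itself is the target under which \<open>distr_PiM_component\<close> applies.\<close>
    also have "\<dots> = distr (Pi\<^sub>M UNIV ?N) (?N j) (\<lambda>x. x j)"
      by (rule distr_cong) auto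
    also have "\<dots> = ?N j"
      by (rule distr_PiM_component) (auto intro: N)
    finally show ?thesis .
  qed
  interpret prob_space "isotropic_normal \<theta> \<sigma>"
    using assms by (rule prob_space_isotropic_normal)
  have "distributed (isotropic_normal \<theta> \<sigma>) lborel (\<lambda>X. X $ j) (normal_density (\<theta> $ j) \<sigma>)"
    using comp by (simp add: distributed_def distr_cong[of _ _ borel lborel])
  then have "distributed (isotropic_normal \<theta> \<sigma>) lborel (\<lambda>X. (X $ j - \<theta> $ j) / \<sigma>) std_normal_density"
    by (rule iffD1[OF normal_standard_normal_convert[OF assms]])
  then show ?thesis
    by (simp add: distributed_def distr_cong[of _ _ borel lborel])
qed

lemma prob_standardized_coordinate:
  fixes \<theta> :: "real ^ 'd :: finite"
  assumes "\<sigma> > 0" "A \<in> sets borel"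
  shows "\<P>(X in isotropic_normal \<theta> \<sigma>. (X $ j - \<theta> $ j) / \<sigma> \<in> A) = measure std_normal_distribution A"
proof -
  have "measure std_normal_distribution A
      = measure (distr (isotropic_normal \<theta> \<sigma>) borel (\<lambda>X. (X $ j - \<theta> $ j) / \<sigma>)) A"
    by (simp add: distr_isotropic_normal_standardized[OF assms(1)])
  also have "\<dots> = \<P>(X in isotropic_normal \<theta> \<sigma>. (X $ j - \<theta> $ j) / \<sigma> \<in> A)"
    using assms by (subst measure_distr) (auto simp: vimage_def)
  finally show ?thesis ..
qed

lemma prob_standardized_tail:
  fixes \<theta> :: "real ^ 'd :: finite"
  assumes "\<sigma> > 0"
  shows "\<P>(X in isotropic_normal \<theta> \<sigma>. t \<le> \<bar>(X $ j - \<theta> $ j) / \<sigma>\<bar>) \<le> 2 * (1 - Phi t)"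
  using prob_standardized_coordinate[OF assms, of "{x. t \<le> \<bar>x\<bar>}" \<theta> j] std_normal_two_sided_tail[of t]
  by simp

text \<open>To bring \<open>X $ j\<close> below the threshold, the standardized noise must move it
  towards zero by more than \<open>a / \<sigma> - c\<close>. This is a one-sided event whose
  direction is given by the sign of \<open>\<theta> $ j\<close>; the two directions have equal
  probability by symmetry.\<close>

lemma prob_missed_signal:
  fixes \<theta> :: "real ^ 'd :: finite"
  assumes "\<sigma> > 0" "a \<le> \<bar>\<theta> $ j\<bar>"
  shows "\<P>(X in isotropic_normal \<theta> \<sigma>. \<bar>X $ j\<bar> / \<sigma> < c) \<le> Phi (c - a / \<sigma>)"
proof -
  interpret prob_space "isotropic_normal \<theta> \<sigma>"
    using assms(1) by (rule prob_space_isotropic_normal)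
  show ?thesis
  proof (cases "\<theta> $ j \<ge> 0")
    case True
    then have "a / \<sigma> \<le> \<theta> $ j / \<sigma>"
      using assms by (intro divide_right_mono) auto
    then have "\<P>(X in isotropic_normal \<theta> \<sigma>. \<bar>X $ j\<bar> / \<sigma> < c)
        \<le> \<P>(X in isotropic_normal \<theta> \<sigma>. (X $ j - \<theta> $ j) / \<sigma> \<in> {..c - a / \<sigma>})"
    proof (intro finite_measure_mono subsetI)
      fix X assume "X \<in> {X \<in> space (isotropic_normal \<theta> \<sigma>). \<bar>X $ j\<bar> / \<sigma> < c}"
      then have "\<bar>X $ j\<bar> / \<sigma> < c" by simp
      moreover have "X $ j / \<sigma> \<le> \<bar>X $ j\<bar> / \<sigma>"
        using assms(1) by (intro divide_right_mono) auto
      ultimately show "X \<in> {X \<in> space (isotropic_normal \<theta> \<sigma>). (X $ j - \<theta> $ j) / \<sigma> \<in> {..c - a / \<sigma>}}"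
        using \<open>a / \<sigma> \<le> \<theta> $ j / \<sigma>\<close> by (simp add: diff_divide_distrib)
    qed simp
    also have "\<dots> = Phi (c - a / \<sigma>)"
      using assms(1) by (subst prob_standardized_coordinate) (auto simp: Phi_def cdf_def)
    finally show ?thesis .
  next
    case False
    then have le: "\<theta> $ j / \<sigma> \<le> - (a / \<sigma>)"
      using assms by (simp add: field_simps)
    have "\<P>(X in isotropic_normal \<theta> \<sigma>. \<bar>X $ j\<bar> / \<sigma> < c)
        \<le> \<P>(X in isotropic_normal \<theta> \<sigma>. (X $ j - \<theta> $ j) / \<sigma> \<in> {a / \<sigma> - c<..})"
    proof (intro finite_measure_mono subsetI)
      fix X assume "X \<in> {X \<in> space (isotropic_normal \<theta> \<sigma>). \<bar>X $ j\<bar> / \<sigma> < c}"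
      then have "\<bar>X $ j\<bar> / \<sigma> < c" by simp
      moreover have "- (X $ j) / \<sigma> \<le> \<bar>X $ j\<bar> / \<sigma>"
        using assms(1) by (intro divide_right_mono) auto
      ultimately show "X \<in> {X \<in> space (isotropic_normal \<theta> \<sigma>).
          (X $ j - \<theta> $ j) / \<sigma> \<in> {a / \<sigma> - c<..}}"
        using le by (simp add: diff_divide_distrib)
    qed simp
    also have "\<dots> = 1 - Phi (a / \<sigma> - c)"
      using assms(1) by (subst prob_standardized_coordinate) (auto simp: measure_std_normal_greaterThan)
    also have "\<dots> = Phi (c - a / \<sigma>)"
      using Phi_minus[of "a / \<sigma> - c"] by simp
    finally show ?thesis .
  qed
qed

section \<open>Selection and coverage\<close>

text \<open>The condition on \<open>phi_star\<close> says precisely that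
  \<open>Phi_inv (\<alpha>' / (2 * real s)) + a / \<sigma>\<close> is at least
  \<open>Phi_inv ((1 + \<delta>) / 2)\<close>. The latter is nonnegative, as
  \<open>Phi 0 = 1 / 2\<close>, so both maxima collapse.\<close>

lemma S_TS_eq:
  assumes "0 < \<delta>" "\<delta> < 1" "phi_star s \<delta> \<alpha>' \<le> a / \<sigma>"
  shows "S_TS s a \<sigma> \<delta> \<alpha>' X = {j. Phi_inv (\<alpha>' / (2 * real s)) + a / \<sigma> \<le> \<bar>X $ j\<bar> / \<sigma>}"
proof -
  have "Phi 0 < Phi (Phi_inv ((1 + \<delta>) / 2))"
    using assms by (simp add: Phi_zero Phi_Phi_inv)
  then have "0 \<le> Phi_inv ((1 + \<delta>) / 2)"
    using monoD[OF mono_Phi, of "Phi_inv ((1 + \<delta>) / 2)" 0] by linarith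
  moreover have "Phi_inv ((1 + \<delta>) / 2) \<le> Phi_inv (\<alpha>' / (2 * real s)) + a / \<sigma>"
    using assms(3) by (simp add: phi_star_def add.commute)
  ultimately show ?thesis
    unfolding S_TS_def by (auto simp: max_def)
qed

text \<open>At a zero coordinate, selection is a two-sided noise tail at a threshold no smaller than
  \<open>Phi_inv ((1 + \<delta>) / 2)\<close>, and
  \<open>2 * (1 - (1 + \<delta>) / 2) = 1 - \<delta>\<close>.\<close>

lemma selection_prob_le:
  fixes \<theta> :: "real ^ 'd :: finite"
  assumes "\<sigma> > 0" "0 < \<delta>" "\<delta> < 1" "phi_star s \<delta> \<alpha>' \<le> a / \<sigma>" "\<theta> $ j = 0"
  shows "\<P>(X in isotropic_normal \<theta> \<sigma>. j \<in> S_TS s a \<sigma> \<delta> \<alpha>' X) \<le> 1 - \<delta>"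
proof -
  let ?c = "Phi_inv (\<alpha>' / (2 * real s)) + a / \<sigma>"
  have "\<P>(X in isotropic_normal \<theta> \<sigma>. j \<in> S_TS s a \<sigma> \<delta> \<alpha>' X)
      = \<P>(X in isotropic_normal \<theta> \<sigma>. ?c \<le> \<bar>(X $ j - \<theta> $ j) / \<sigma>\<bar>)"
    using assms by (simp add: S_TS_eq)
  also have "\<dots> \<le> 2 * (1 - Phi ?c)"
    using assms(1) by (rule prob_standardized_tail)
  also have "\<dots> \<le> 1 - \<delta>"
    using monoD[OF mono_Phi, of "Phi_inv ((1 + \<delta>) / 2)" ?c] assms
    by (simp add: phi_star_def Phi_Phi_inv add.commute)
  finally show ?thesis .
qed

lemma noncoverage_prob_le:
  fixes \<theta> :: "real ^ 'd :: finite"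
  assumes s: "1 \<le> s" "s \<le> CARD('d)" and "\<sigma> > 0" and \<delta>: "0 < \<delta>" "\<delta> < 1"
    and \<alpha>: "\<alpha> < 1" "0 < \<alpha>'" "\<alpha>' < \<alpha>"
    and a: "phi_star s \<delta> \<alpha>' \<le> a / \<sigma>" and \<theta>: "\<theta> \<in> Theta s a"
  shows "\<P>(X in isotropic_normal \<theta> \<sigma>. \<theta> \<notin> M_TS s a \<sigma> \<delta> \<alpha> \<alpha>' X) \<le> \<alpha>"
proof -
  interpret prob_space "isotropic_normal \<theta> \<sigma>"
    using \<open>\<sigma> > 0\<close> by (rule prob_space_isotropic_normal)
  define d where "d = real CARD('d)"
  define c where "c = Phi_inv (\<alpha>' / (2 * real s)) + a / \<sigma>"
  define u where "u = u_TS CARD('d) s a \<sigma> \<delta> \<alpha> \<alpha>'"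
  define T where "T = {j. \<theta> $ j \<noteq> 0}"
  \<comment> \<open>For \<open>j\<close> in the support, \<open>E j\<close> is a missed signal.
    \<open>F j\<close> contains the failures of the interval at \<open>j\<close>. At a zero
    coordinate \<open>G j\<close> is false selection.\<close>
  define E where "E j = {X \<in> space (isotropic_normal \<theta> \<sigma>). \<bar>X $ j\<bar> / \<sigma> < c}" for j
  define F where "F j = {X \<in> space (isotropic_normal \<theta> \<sigma>). u \<le> \<bar>(X $ j - \<theta> $ j) / \<sigma>\<bar>}" for j
  define G where "G j = {X \<in> space (isotropic_normal \<theta> \<sigma>). c \<le> \<bar>(X $ j - \<theta> $ j) / \<sigma>\<bar>}" for j
  have [measurable]: "E j \<in> sets borel" "F j \<in> sets borel" "G j \<in> sets borel" for j
    unfolding E_def F_def G_def by simp_all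
  have T: "card T \<le> s" "\<And>j. j \<in> T \<Longrightarrow> a \<le> \<bar>\<theta> $ j\<bar>"
    using \<theta> by (auto simp: Theta_def T_def)
  have s_pos: "real s > 0" and d_pos: "d > 0" and s_le: "real s \<le> d"
    using s by (auto simp: d_def)
  have F_le: "prob (F j) \<le> 2 * (1 - Phi u)" and G_le: "prob (G j) \<le> 2 * (1 - Phi c)" for j
    unfolding F_def G_def using \<open>\<sigma> > 0\<close> by (rule prob_standardized_tail)+
  have p': "0 < \<alpha>' / (2 * real s)" "\<alpha>' / (2 * real s) < 1"
    using \<alpha> s by (auto simp: field_simps)
  have E_le: "prob (\<Union>j\<in>T. E j) \<le> \<alpha>'"
  proof -
    have "prob (\<Union>j\<in>T. E j) \<le> (\<Sum>j\<in>T. prob (E j))"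
      by (intro finite_measure_subadditive_finite) auto
    also have "\<dots> \<le> (\<Sum>j\<in>T. \<alpha>' / (2 * real s))"
    proof (rule sum_mono)
      fix j assume "j \<in> T"
      then have "prob (E j) \<le> Phi (c - a / \<sigma>)"
        unfolding E_def using \<open>\<sigma> > 0\<close> by (intro prob_missed_signal T)
      then show "prob (E j) \<le> \<alpha>' / (2 * real s)"
        by (simp add: c_def Phi_Phi_inv[OF p'])
    qed
    also have "\<dots> \<le> real s * (\<alpha>' / (2 * real s))"
      unfolding sum_constant using T(1) less_imp_le[OF p'(1)] by (intro mult_right_mono) auto
    \<comment> \<open>The union bound gives \<open>\<alpha>' / 2\<close>, relaxed here to the share
      \<open>\<alpha>'\<close> of the error budget.\<close>
    also have "\<dots> \<le> \<alpha>'"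
      using s_pos \<alpha> by simp
    finally show ?thesis .
  qed
  \<comment> \<open>\<open>R\<close> is the set of coordinates charged for their intervals. Outside
    \<open>R\<close> the parameter vanishes, and an interval can fail there only if the coordinate
    was selected. \<open>R\<close> is chosen later according to the branch of
    \<open>u\<close>.\<close>
  have cover: "{X \<in> space (isotropic_normal \<theta> \<sigma>). \<theta> \<notin> M_TS s a \<sigma> \<delta> \<alpha> \<alpha>' X}
      \<subseteq> (\<Union>j\<in>T. E j) \<union> (\<Union>j\<in>UNIV. if j \<in> R then F j else G j)" if "T \<subseteq> R" for R
  proof
    fix X assume "X \<in> {X \<in> space (isotropic_normal \<theta> \<sigma>). \<theta> \<notin> M_TS s a \<sigma> \<delta> \<alpha> \<alpha>' X}"
    then obtain j where j: "\<bar>X $ j\<bar> / \<sigma> < c \<and> \<theta> $ j \<noteq> 0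
        \<or> c \<le> \<bar>X $ j\<bar> / \<sigma> \<and> \<not> (X $ j - u * \<sigma> \<le> \<theta> $ j \<and> \<theta> $ j \<le> X $ j + u * \<sigma>)"
      by (auto simp: M_TS_def conf_set_def S_TS_eq[OF \<delta> a] L_TS_def U_TS_def c_def u_def not_le)
    have far: "u \<le> \<bar>(X $ j - \<theta> $ j) / \<sigma>\<bar>"
      if "\<not> (X $ j - u * \<sigma> \<le> \<theta> $ j \<and> \<theta> $ j \<le> X $ j + u * \<sigma>)"
      using that \<open>\<sigma> > 0\<close> by (auto simp: field_simps abs_if)
    show "X \<in> (\<Union>j\<in>T. E j) \<union> (\<Union>j\<in>UNIV. if j \<in> R then F j else G j)"
    proof (cases "\<bar>X $ j\<bar> / \<sigma> < c")
      case True
      then show ?thesis using j by (auto simp: T_def E_def)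
    next
      case False
      moreover have "\<theta> $ j = 0" if "j \<notin> R"
        using that \<open>T \<subseteq> R\<close> by (auto simp: T_def)
      ultimately have "X \<in> (if j \<in> R then F j else G j)"
        using j far \<open>\<sigma> > 0\<close> by (auto simp: F_def G_def)
      then show ?thesis by blast
    qed
  qed
  have main: "prob {X \<in> space (isotropic_normal \<theta> \<sigma>). \<theta> \<notin> M_TS s a \<sigma> \<delta> \<alpha> \<alpha>' X}
      \<le> \<alpha>' + (real (card R) * (2 * (1 - Phi u)) + (d - real (card R)) * (2 * (1 - Phi c)))"
    if R: "T \<subseteq> R" for R
  proof -
    have "prob {X \<in> space (isotropic_normal \<theta> \<sigma>). \<theta> \<notin> M_TS s a \<sigma> \<delta> \<alpha> \<alpha>' X}
        \<le> prob ((\<Union>j\<in>T. E j) \<union> (\<Union>j\<in>UNIV. if j \<in> R then F j else G j))"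
      by (intro finite_measure_mono cover R) auto
    also have "\<dots> \<le> prob (\<Union>j\<in>T. E j) + prob (\<Union>j\<in>UNIV. if j \<in> R then F j else G j)"
      by (intro measure_Un_le) auto
    also have "prob (\<Union>j\<in>UNIV. if j \<in> R then F j else G j)
        \<le> (\<Sum>j\<in>UNIV. prob (if j \<in> R then F j else G j))"
      by (intro finite_measure_subadditive_finite) auto
    also have "\<dots> \<le> (\<Sum>j\<in>UNIV. if j \<in> R then 2 * (1 - Phi u) else 2 * (1 - Phi c))"
      using F_le G_le by (intro sum_mono) auto
    also have "\<dots> = real (card R) * (2 * (1 - Phi u)) + (d - real (card R)) * (2 * (1 - Phi c))"
      by (simp add: sum.If_cases Compl_eq_Diff_UNIV card_Diff_subset of_nat_diff card_mono d_def)
    finally show ?thesis using E_le by simp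
  qed
  show ?thesis
  proof (cases "a / \<sigma> < max (phi_star s \<delta> \<alpha>')
      (- Phi_inv ((\<alpha> - \<alpha>') / (2 * d)) - Phi_inv (\<alpha>' / (2 * real s)))")
    case True
    have p: "0 < 1 - (\<alpha> - \<alpha>') / (2 * d)" "1 - (\<alpha> - \<alpha>') / (2 * d) < 1"
      using \<alpha> s_le s by (auto simp: field_simps)
    have "u = Phi_inv (1 - (\<alpha> - \<alpha>') / (2 * d))"
      using True a unfolding u_def u_TS_def Let_def d_def by (simp only: simp_thms if_True)
    then have u: "1 - Phi u = (\<alpha> - \<alpha>') / (2 * d)"
      using Phi_Phi_inv[OF p] by simp
    \<comment> \<open>With \<open>R = UNIV\<close> no \<open>G\<close> term remains, and the
      \<open>d\<close> tails of size \<open>(\<alpha> - \<alpha>') / d\<close> add up to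
      \<open>\<alpha> - \<alpha>'\<close>.\<close>
    show ?thesis
      using main[of UNIV] d_pos unfolding u d_def[symmetric] by (simp add: field_simps)
  next
    case False
    \<comment> \<open>The part of \<open>\<alpha> - \<alpha>'\<close> left for \<open>s\<close>
      intervals after paying for \<open>d - s\<close> false selections; \<open>Phi c\<close> is the
      \<eta> of \<open>u_TS\<close>.\<close>
    define \<beta> where "\<beta> = \<alpha> - \<alpha>' - 2 * (d - real s) * (1 - Phi c)"
    have q: "0 < (\<alpha> - \<alpha>') / (2 * d)" "(\<alpha> - \<alpha>') / (2 * d) < 1"
      using \<alpha> s_le s by (auto simp: field_simps)
    \<comment> \<open>The second branch means that \<open>c\<close> is at least
      \<open>- Phi_inv ((\<alpha> - \<alpha>') / (2 * d))\<close>, which is turned into a value of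
      \<open>Phi\<close> by symmetry.\<close>
    have "1 - (\<alpha> - \<alpha>') / (2 * d) \<le> Phi c"
      using False monoD[OF mono_Phi, of "- Phi_inv ((\<alpha> - \<alpha>') / (2 * d))" c]
      by (simp add: Phi_minus Phi_Phi_inv[OF q] c_def)
    then have "(d - real s) * (1 - Phi c) \<le> (d - real s) * ((\<alpha> - \<alpha>') / (2 * d))"
      using s_le by (intro mult_left_mono) auto
    \<comment> \<open>Strict because \<open>s \<ge> 1\<close>; this makes \<beta> positive and keeps
      the argument of \<open>Phi_inv\<close> below 1.\<close>
    also have "\<dots> < d * ((\<alpha> - \<alpha>') / (2 * d))"
      using s_pos q by (intro mult_strict_right_mono) auto
    also have "\<dots> = (\<alpha> - \<alpha>') / 2"
      using d_pos by simp
    finally have "\<beta> > 0"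
      unfolding \<beta>_def by argo
    have "Phi c \<le> 1"
      unfolding Phi_def by (rule std_normal.cdf_bounded_prob)
    then have "0 \<le> (d - real s) * (1 - Phi c)"
      using s_le by simp
    then have "\<beta> < 1"
      using \<alpha> unfolding \<beta>_def by argo
    have p: "0 < 1 - \<beta> / (2 * real s)" "1 - \<beta> / (2 * real s) < 1"
      using \<open>\<beta> > 0\<close> \<open>\<beta> < 1\<close> s by (auto simp: field_simps)
    have "u = Phi_inv (1 - \<beta> / (2 * real s))"
      using False by (simp add: u_def u_TS_def Let_def d_def \<beta>_def c_def add.commute)
    then have u: "real s * (2 * (1 - Phi u)) = \<beta>"
      using Phi_Phi_inv[OF p] s_pos by simp
    \<comment> \<open>The support may have fewer than \<open>s\<close> elements. It is padded to
      exactly \<open>s\<close>, so that the interval tails sum to \<beta> and the \<open>G\<close>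
      terms restore what \<beta> left out.\<close>
    obtain R where R: "T \<subseteq> R" "card R = s"
      using exists_subset_between[OF T(1) s(2)] by auto
    show ?thesis
      using main[OF R(1)] unfolding R(2) u \<beta>_def by argo
  qed
qed

theorem theorem5p2:
  fixes s :: nat and a \<sigma> \<delta> \<alpha> \<alpha>' :: real
  assumes "1 \<le> s" and "s \<le> CARD('d :: finite)"
    and "a > 0" and "\<sigma> > 0"
    and "0 < \<delta>" and "\<delta> < 1"
    and "0 < \<alpha>" and "\<alpha> < 1"
    and "0 < \<alpha>'" and "\<alpha>' < \<alpha>"
    and "a / \<sigma> \<ge> phi_star s \<delta> \<alpha>'"
  shows "(\<forall>j :: 'd. (SUP \<theta> \<in> {\<theta> \<in> Theta s a. \<theta> $ j = 0}.
            \<P>(X in isotropic_normal \<theta> \<sigma>. j \<in> S_TS s a \<sigma> \<delta> \<alpha>' X)) \<le> 1 - \<delta>)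
       \<and> (SUP \<theta> \<in> (Theta s a :: (real ^ 'd) set).
            \<P>(X in isotropic_normal \<theta> \<sigma>. \<theta> \<notin> M_TS s a \<sigma> \<delta> \<alpha> \<alpha>' X)) \<le> \<alpha>"
proof -
  \<comment> \<open>The zero vector makes the index sets of both suprema nonempty, as
    \<open>cSUP_least\<close> requires.\<close>
  have "(0 :: real ^ 'd) \<in> Theta s a"
    by (simp add: Theta_def)
  then show ?thesis
    by (intro conjI allI cSUP_least selection_prob_le noncoverage_prob_le assms) auto
qed

end
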